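(* For every commutative BCK-algebra $\mathbf{A}$, the spectrum $\mathrm{X}(\mathbf{A})$ is a locally compact generalized spectral space.
   Context: A commutative BCK-algebra is an algebra $\mathbf{A}=\langle A;\cdot,0\rangle$ of type $(2,0)$ such that for all $x,y,z\in A$: $(x\cdot y)\cdot z=(x\cdot z)\cdot y$; $x\cdot(x\cdot y)=y\cdot(y\cdot x)$; $x\cdot x=0$; $x\cdot 0=x$. Put $x\wedge y:=y\cdot(y\cdot x)$; this is the meet for the partial order $x\le y\iff x\cdot y=0$. An ideal is a subset $I\subseteq A$ with $0\in I$ such that $x\cdot y\in I$ and $y\in I$ imply $x\in I$. An ideal $P$ is prime if $P\neq A$ and $x\wedge y\in P$ implies $x\in P$ or $y\in P$. The spectrum of $\mathbf{A}$ is the set $\mathrm{X}(\mathbf{A})$ of prime ideals of $\mathbf{A}$ with the topology whose open sets are exactly the sets $\sigma(I)=\{P\in\mathrm{X}(\mathbf{A})\mid I\not\subseteq P\}$, $I$ an ideal of $\mathbf{A}$. A topological space $X$ is a generalized spectral space if: (i) $X$ is $T_0$; (ii) the compact open subsets of $X$ form a basis for the topology that is closed under finite (i.e. pairwise) intersections; (iii) $X$ is quasi-sober, i.e. every non-empty irreducible closed subset is the closure of a point. (Compactness of $X$ is not required, and "compact" does not include Hausdorff.) *)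

theory Defs
  imports "HOL-Analysis.Analysis"
begin

locale comm_bck_algebra =
  fixes A :: "'a set" and bmult :: "'a \<Rightarrow> 'a \<Rightarrow> 'a" (infixl "\<cdot>" 70) and zero :: 'a ("\<zero>")
  assumes mult_closed: "x \<in> A \<Longrightarrow> y \<in> A \<Longrightarrow> x \<cdot> y \<in> A"
    and zero_closed: "\<zero> \<in> A"
    and exchange: "x \<in> A \<Longrightarrow> y \<in> A \<Longrightarrow> z \<in> A \<Longrightarrow> (x \<cdot> y) \<cdot> z = (x \<cdot> z) \<cdot> y"
    and comm: "x \<in> A \<Longrightarrow> y \<in> A \<Longrightarrow> x \<cdot> (x \<cdot> y) = y \<cdot> (y \<cdot> x)"
    and mult_self: "x \<in> A \<Longrightarrow> x \<cdot> x = \<zero>"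
    and mult_zero: "x \<in> A \<Longrightarrow> x \<cdot> \<zero> = x"
begin

definition meet :: "'a \<Rightarrow> 'a \<Rightarrow> 'a" (infixl "\<sqinter>" 70)
  where "x \<sqinter> y = y \<cdot> (y \<cdot> x)"

definition ideal :: "'a set \<Rightarrow> bool"
  where "ideal I \<longleftrightarrow> I \<subseteq> A \<and> \<zero> \<in> I \<and> (\<forall>x\<in>A. \<forall>y\<in>A. x \<cdot> y \<in> I \<and> y \<in> I \<longrightarrow> x \<in> I)"

definition prime_ideal :: "'a set \<Rightarrow> bool"
  where "prime_ideal P \<longleftrightarrow>
    ideal P \<and> P \<noteq> A \<and> (\<forall>x\<in>A. \<forall>y\<in>A. x \<sqinter> y \<in> P \<longrightarrow> x \<in> P \<or> y \<in> P)"

definition sigma :: "'a set \<Rightarrow> 'a set set" ("\<sigma>")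
  where "\<sigma> I = {P. prime_ideal P \<and> \<not> I \<subseteq> P}"

definition spectrum :: "'a set topology"
  where "spectrum = topology (\<lambda>U. \<exists>I. ideal I \<and> U = \<sigma> I)"

text \<open>The sets \<^term>\<open>\<sigma> I\<close> do form a topology, so that \<^const>\<open>topology\<close> in the definition of
  \<^const>\<open>spectrum\<close> is not applied outside its domain.\<close>

lemma zero_mult: "\<zero> \<cdot> a = \<zero>" if a: "a \<in> A"
proof -
  let ?b = "\<zero> \<cdot> a"
  have b: "?b \<in> A" using a by (simp add: mult_closed zero_closed)
  have "\<zero> \<cdot> ?b = \<zero>" using comm[OF zero_closed a] a by (simp add: mult_zero mult_self)
  then have "?b = (\<zero> \<cdot> ?b) \<cdot> a" by simp
  also have "\<dots> = ?b \<cdot> ?b" using exchange[OF zero_closed b a] .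
  finally show ?thesis using b by (simp add: mult_self)
qed

lemma ideal_subset: "ideal I \<Longrightarrow> I \<subseteq> A"
  by (simp add: ideal_def)

lemma ideal_multD: "x \<in> I" if "ideal I" "x \<in> A" "x \<cdot> y \<in> I" "y \<in> I"
proof -
  have "y \<in> A" using ideal_subset[OF that(1)] that(4) by (rule subsetD)
  moreover have "\<forall>x\<in>A. \<forall>y\<in>A. x \<cdot> y \<in> I \<and> y \<in> I \<longrightarrow> x \<in> I"
    using that(1) unfolding ideal_def by (elim conjE)
  ultimately show ?thesis using that(2-4) by blast
qed

lemma ideal_meet_right: "x \<sqinter> y \<in> I" if "ideal I" "x \<in> A" "y \<in> I"
proof -
  have y: "y \<in> A" using ideal_subset[OF that(1)] that(3) by (rule subsetD)
  then have yx: "y \<cdot> x \<in> A" and m: "x \<sqinter> y \<in> A"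
    using that(2) by (simp_all add: meet_def mult_closed)
  have "(x \<sqinter> y) \<cdot> y = (y \<cdot> y) \<cdot> (y \<cdot> x)"
    unfolding meet_def using exchange[OF y yx y] .
  then have "(x \<sqinter> y) \<cdot> y = \<zero>" using y yx by (simp add: mult_self zero_mult)
  moreover have "\<zero> \<in> I" using that(1) by (simp add: ideal_def)
  ultimately show ?thesis using ideal_multD[OF that(1) m, of y] that(3) by simp
qed

lemma ideal_meet_left: "x \<sqinter> y \<in> I" if "ideal I" "x \<in> I" "y \<in> A"
proof -
  have "x \<in> A" using ideal_subset[OF that(1)] that(2) by (rule subsetD)
  then have "x \<sqinter> y = y \<sqinter> x" using comm[OF \<open>x \<in> A\<close> \<open>y \<in> A\<close>] by (simp only: meet_def)
  then show ?thesis using ideal_meet_right[OF that(1) that(3) that(2)] by (simp only:)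
qed

lemma Int_sigma:
  assumes "ideal I" "ideal J"
  shows "\<sigma> I \<inter> \<sigma> J = \<sigma> (I \<inter> J)"
proof
  show "\<sigma> I \<inter> \<sigma> J \<subseteq> \<sigma> (I \<inter> J)"
  proof
    fix P assume P: "P \<in> \<sigma> I \<inter> \<sigma> J"
    then obtain x y where xy: "x \<in> I" "x \<notin> P" "y \<in> J" "y \<notin> P" by (auto simp: sigma_def)
    have A: "x \<in> A" "y \<in> A" using xy assms[THEN ideal_subset] by blast+
    have "x \<sqinter> y \<in> I \<inter> J"
      using ideal_meet_left[OF assms(1) xy(1) A(2)] ideal_meet_right[OF assms(2) A(1) xy(3)] by simp
    moreover have "prime_ideal P" using P by (simp add: sigma_def)
    then have "x \<sqinter> y \<notin> P" using xy A by (auto simp: prime_ideal_def)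
    ultimately show "P \<in> \<sigma> (I \<inter> J)" using P by (auto simp: sigma_def)
  qed
qed (auto simp: sigma_def)

lemma istopology_sigma: "istopology (\<lambda>U. \<exists>I. ideal I \<and> U = \<sigma> I)"
  unfolding istopology_def
proof (intro conjI allI impI)
  fix S T assume "\<exists>I. ideal I \<and> S = \<sigma> I" "\<exists>I. ideal I \<and> T = \<sigma> I"
  then obtain I J where IJ: "ideal I" "S = \<sigma> I" "ideal J" "T = \<sigma> J" by auto
  have "ideal (I \<inter> J)"
    unfolding ideal_def
  proof (intro conjI ballI impI)
    fix x y assume "x \<in> A" "y \<in> A" "x \<cdot> y \<in> I \<inter> J \<and> y \<in> I \<inter> J"
    then show "x \<in> I \<inter> J" using ideal_multD[OF IJ(1)] ideal_multD[OF IJ(3)] by auto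
  qed (use IJ in \<open>auto simp: ideal_def\<close>)
  then show "\<exists>K. ideal K \<and> S \<inter> T = \<sigma> K" using IJ Int_sigma by blast
next
  fix \<K> assume K: "\<forall>S\<in>\<K>. \<exists>I. ideal I \<and> S = \<sigma> I"
  define L where "L = \<Union>{I. ideal I \<and> \<sigma> I \<in> \<K>}"
  define G where "G = A \<inter> \<Inter>{I. ideal I \<and> L \<subseteq> I}"
  have "ideal G"
    unfolding ideal_def
  proof (intro conjI ballI impI)
    fix x y assume xy: "x \<in> A" "y \<in> A" and in_G: "x \<cdot> y \<in> G \<and> y \<in> G"
    have "x \<in> I" if I: "ideal I" "L \<subseteq> I" for I
    proof -
      have "x \<cdot> y \<in> I" "y \<in> I" using in_G I unfolding G_def by blast+
      then show ?thesis using ideal_multD[OF I(1)] xy by auto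
    qed
    then show "x \<in> G" using xy unfolding G_def by blast
  qed (auto simp: G_def ideal_def zero_closed)
  have eq: "G \<subseteq> P \<longleftrightarrow> L \<subseteq> P" if "prime_ideal P" for P
  proof -
    have "ideal P" using that by (simp add: prime_ideal_def)
    moreover have "L \<subseteq> A" unfolding L_def by (auto simp: ideal_def)
    then have "L \<subseteq> G" unfolding G_def by blast
    ultimately show ?thesis unfolding G_def by blast
  qed
  have "\<Union>\<K> = \<sigma> G"
  proof (intro equalityI subsetI)
    fix P assume "P \<in> \<Union>\<K>"
    then obtain S where S: "S \<in> \<K>" "P \<in> S" by blast
    then obtain I where I: "ideal I" "S = \<sigma> I" using K by blast
    then have P: "prime_ideal P" "\<not> I \<subseteq> P" using S by (auto simp: sigma_def)
    have "I \<subseteq> L" unfolding L_def using I S by blast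
    then show "P \<in> \<sigma> G" using P eq[of P] by (auto simp: sigma_def)
  next
    fix P assume "P \<in> \<sigma> G"
    then have P: "prime_ideal P" "\<not> L \<subseteq> P" using eq[of P] by (auto simp: sigma_def)
    then obtain I where I: "\<sigma> I \<in> \<K>" "\<not> I \<subseteq> P" unfolding L_def by blast
    then have "P \<in> \<sigma> I" using P by (simp add: sigma_def)
    then show "P \<in> \<Union>\<K>" using I by blast
  qed
  with \<open>ideal G\<close> show "\<exists>I. ideal I \<and> \<Union>\<K> = \<sigma> I" by blast
qed

lemma openin_spectrum: "openin spectrum U \<longleftrightarrow> (\<exists>I. ideal I \<and> U = \<sigma> I)"
  by (simp add: spectrum_def topology_inverse'[OF istopology_sigma])

lemma topspace_spectrum: "topspace spectrum = {P. prime_ideal P}"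
proof -
  have "ideal A" by (simp add: ideal_def zero_closed)
  moreover have "\<sigma> A = {P. prime_ideal P}"
    by (auto simp: sigma_def prime_ideal_def ideal_def)
  ultimately show ?thesis
    unfolding topspace_def openin_spectrum by (auto simp: sigma_def)
qed

end

definition irreducible_closedin :: "'b topology \<Rightarrow> 'b set \<Rightarrow> bool"
  where "irreducible_closedin X C \<longleftrightarrow> closedin X C \<and> C \<noteq> {} \<and>
    (\<forall>F G. closedin X F \<and> closedin X G \<and> C = F \<union> G \<longrightarrow> C = F \<or> C = G)"

definition quasi_sober :: "'b topology \<Rightarrow> bool"
  where "quasi_sober X \<longleftrightarrow>
    (\<forall>C. irreducible_closedin X C \<longrightarrow> (\<exists>x\<in>topspace X. C = X closure_of {x}))"

abbreviation compact_openin :: "'b topology \<Rightarrow> 'b set \<Rightarrow> bool"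
  where "compact_openin X U \<equiv> openin X U \<and> compactin X U"

definition generalized_spectral_space :: "'b topology \<Rightarrow> bool"
  where "generalized_spectral_space X \<longleftrightarrow>
    t0_space X \<and>
    openin X = arbitrary union_of (compact_openin X) \<and>
    (\<forall>U V. compact_openin X U \<and> compact_openin X V \<longrightarrow> compact_openin X (U \<inter> V)) \<and>
    quasi_sober X"

end

theory Submission
  imports Defs
begin

text \<open>
  Everything rests on one separation property: an ideal \<open>I\<close> and an element \<open>x\<close> outside it are
  separated by a prime ideal containing \<open>I\<close> but not \<open>x\<close> (\<open>prime_ideal_separation\<close>). An ideal
  \<open>P\<close> maximal among those that contain \<open>I\<close> and omit \<open>x\<close> exists by Zorn's lemma, and it is prime
  because every set \<open>{y \<in> A. y \<sqinter> a \<in> P}\<close> is again an ideal (\<open>ideal_colon\<close>). The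
  calculations in the algebra serve this last fact.

  Write \<open>D a\<close> for the set of prime ideals that omit \<open>a\<close>. The ideal axiom reads
  \<open>D x \<subseteq> D (x \<cdot> y) \<union> D y\<close>, so for any family of sets closed under
  subsets and finite unions, the elements \<open>y\<close> with \<open>D y\<close> in the family form an ideal
  (\<open>ideal_covered\<close>). For the family of subsets of \<open>D a\<close> this shows that
  \<open>D a\<close> is open. For the family of sets covered by finitely many members of an open cover of
  \<open>D a\<close>, separation shows that the ideal contains \<open>a\<close>, which means that \<open>D a\<close> is compact. For the
  family of sets that miss an irreducible closed set \<open>C\<close>, the ideal is the intersection of
  all members of \<open>C\<close>. It is prime because \<open>D (a \<sqinter> b) = D a \<inter> D b\<close>, and it is the generic
  point of \<open>C\<close>.

  So the compact open sets are the finite unions of sets \<open>D a\<close>; they form a basis, are closed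
  under intersection, and provide compact neighbourhoods.
\<close>

section \<open>Order and colon ideals\<close>

context comm_bck_algebra
begin

lemma mult_mult_left_zero:
  assumes "x \<in> A" "y \<in> A" "z \<in> A" "x \<cdot> z = \<zero>"
  shows "(x \<cdot> y) \<cdot> z = \<zero>"
  using assms by (simp add: exchange[of x y z] zero_mult)

text \<open>If \<open>x \<le> y\<close>, then commutativity gives \<open>x = y \<cdot> (y \<cdot> x)\<close>. Substituting this for \<open>x\<close> and
  applying the exchange law twice brings the factor \<open>(y \<cdot> z) \<cdot> (y \<cdot> z) = \<zero>\<close> to the front.\<close>

lemma mult_mono_left:
  assumes x: "x \<in> A" and y: "y \<in> A" and z: "z \<in> A" and le: "x \<cdot> y = \<zero>"
  shows "(x \<cdot> z) \<cdot> (y \<cdot> z) = \<zero>"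
proof -
  have "x = y \<cdot> (y \<cdot> x)"
    using comm[OF x y] le x by (simp add: mult_zero)
  then have "x \<cdot> z = (y \<cdot> z) \<cdot> (y \<cdot> x)"
    using exchange[of y "y \<cdot> x" z] x y z by (simp add: mult_closed)
  then show ?thesis
    using x y z by (simp add: mult_closed mult_self mult_mult_left_zero)
qed

lemma mult_antimono_right:
  assumes x: "x \<in> A" and y: "y \<in> A" and z: "z \<in> A" and le: "x \<cdot> y = \<zero>"
  shows "(z \<cdot> y) \<cdot> (z \<cdot> x) = \<zero>"
proof -
  have "(z \<cdot> y) \<cdot> (z \<cdot> x) = (z \<cdot> (z \<cdot> x)) \<cdot> y"
    using exchange[of z y "z \<cdot> x"] x y z by (simp add: mult_closed)
  also have "\<dots> = (x \<cdot> (x \<cdot> z)) \<cdot> y"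
    using comm[OF z x] by simp
  also have "\<dots> = \<zero>"
    using x y z le by (intro mult_mult_left_zero) (simp_all add: mult_closed)
  finally show ?thesis .
qed

lemma meet_closed: "x \<in> A \<Longrightarrow> y \<in> A \<Longrightarrow> x \<sqinter> y \<in> A"
  by (simp add: meet_def mult_closed)

lemma meet_commute: "x \<in> A \<Longrightarrow> y \<in> A \<Longrightarrow> x \<sqinter> y = y \<sqinter> x"
  by (simp add: meet_def comm[of y x])

lemma meet_idem: "x \<in> A \<Longrightarrow> x \<sqinter> x = x"
  by (simp add: meet_def mult_self mult_zero)

lemma meet_le_right: "x \<in> A \<Longrightarrow> y \<in> A \<Longrightarrow> (x \<sqinter> y) \<cdot> y = \<zero>"
  by (simp add: meet_def mult_closed mult_self mult_mult_left_zero)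

lemma meet_le_left: "x \<in> A \<Longrightarrow> y \<in> A \<Longrightarrow> (x \<sqinter> y) \<cdot> x = \<zero>"
  using meet_le_right[of y x] by (simp add: meet_commute)

lemma le_meetI:
  assumes w: "w \<in> A" and x: "x \<in> A" and y: "y \<in> A" and le: "w \<cdot> x = \<zero>" "w \<cdot> y = \<zero>"
  shows "w \<cdot> (x \<sqinter> y) = \<zero>"
proof -
  have "w = y \<cdot> (y \<cdot> w)"
    using comm[OF w y] le w by (simp add: mult_zero)
  moreover have "(y \<cdot> (y \<cdot> w)) \<cdot> (y \<cdot> (y \<cdot> x)) = \<zero>"
    by (rule mult_antimono_right)
      (use w x y mult_antimono_right[OF w x y le(1)] in \<open>simp_all add: mult_closed\<close>)
  ultimately show ?thesis by (simp add: meet_def)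
qed

lemma zero_in_ideal: "ideal I \<Longrightarrow> \<zero> \<in> I"
  by (simp add: ideal_def)

lemma ideal_downward:
  assumes "ideal I" "x \<in> A" "y \<in> I" "x \<cdot> y = \<zero>"
  shows "x \<in> I"
  using ideal_multD[of I x y] assms by (simp add: zero_in_ideal)

text \<open>For \<open>u = x \<sqinter> a\<close> the elements \<open>u \<cdot> y\<close> and \<open>u \<sqinter> y = u \<cdot> (u \<cdot> y)\<close> lie below
  \<open>(x \<cdot> y) \<sqinter> a\<close> and \<open>y \<sqinter> a\<close> respectively. So if the latter two are in \<open>P\<close>, the ideal axiom
  puts \<open>u\<close> in \<open>P\<close>.\<close>

lemma ideal_colon:
  assumes P: "ideal P" and a: "a \<in> A"
  shows "ideal {y \<in> A. y \<sqinter> a \<in> P}"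
  unfolding ideal_def
proof (intro conjI ballI impI)
  show "\<zero> \<in> {y \<in> A. y \<sqinter> a \<in> P}"
    using P a by (simp add: zero_closed meet_def mult_zero mult_self zero_in_ideal)
next
  fix x y
  assume x: "x \<in> A" and y: "y \<in> A" and "x \<cdot> y \<in> {y \<in> A. y \<sqinter> a \<in> P} \<and> y \<in> {y \<in> A. y \<sqinter> a \<in> P}"
  then have xy: "(x \<cdot> y) \<sqinter> a \<in> P" and ya: "y \<sqinter> a \<in> P" by auto
  define u where "u = x \<sqinter> a"
  have u: "u \<in> A" and ux: "u \<cdot> x = \<zero>" and ua: "u \<cdot> a = \<zero>"
    using x a by (simp_all add: u_def meet_closed meet_le_left meet_le_right)
  have "(u \<cdot> y) \<cdot> ((x \<cdot> y) \<sqinter> a) = \<zero>"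
    using u x y a ux ua by (intro le_meetI mult_mono_left mult_mult_left_zero mult_closed)
  then have "u \<cdot> y \<in> P"
    using ideal_downward[OF P _ xy] u y by (simp add: mult_closed)
  moreover have "u \<cdot> (u \<cdot> y) \<in> P"
  proof -
    have "u \<cdot> (u \<cdot> y) = u \<sqinter> y"
      using comm[OF u y] by (simp add: meet_def)
    moreover have "(u \<cdot> (u \<cdot> y)) \<cdot> a = \<zero>"
      using u y a ua by (intro mult_mult_left_zero mult_closed)
    ultimately have "(u \<sqinter> y) \<cdot> (y \<sqinter> a) = \<zero>"
      using u y a by (intro le_meetI meet_closed meet_le_right) auto
    then show ?thesis
      using ideal_downward[OF P _ ya] u y \<open>u \<cdot> (u \<cdot> y) = u \<sqinter> y\<close> by (simp add: meet_closed)
  qed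
  ultimately have "u \<in> P"
    using ideal_multD[OF P u] by blast
  then show "x \<in> {y \<in> A. y \<sqinter> a \<in> P}"
    using x by (simp add: u_def)
qed auto

lemma ideal_subset_colon:
  assumes "ideal P" "a \<in> A"
  shows "P \<subseteq> {y \<in> A. y \<sqinter> a \<in> P}"
  using assms ideal_subset ideal_meet_left by blast

section \<open>Separation by prime ideals\<close>

lemma ideal_Union_chain:
  assumes "\<C> \<noteq> {}" and ideal: "\<And>I. I \<in> \<C> \<Longrightarrow> ideal I"
    and chain: "\<And>I J. I \<in> \<C> \<Longrightarrow> J \<in> \<C> \<Longrightarrow> I \<subseteq> J \<or> J \<subseteq> I"
  shows "ideal (\<Union>\<C>)"
  unfolding ideal_def
proof (intro conjI ballI impI)
  show "\<Union>\<C> \<subseteq> A" using ideal ideal_subset by blast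
  show "\<zero> \<in> \<Union>\<C>" using \<open>\<C> \<noteq> {}\<close> ideal zero_in_ideal by blast
next
  fix x y assume "x \<in> A" "y \<in> A" "x \<cdot> y \<in> \<Union>\<C> \<and> y \<in> \<Union>\<C>"
  then obtain I J where "I \<in> \<C>" "x \<cdot> y \<in> I" "J \<in> \<C>" "y \<in> J" by blast
  with chain[of I J] obtain K where "K \<in> \<C>" "x \<cdot> y \<in> K" "y \<in> K" by blast
  with \<open>x \<in> A\<close> show "x \<in> \<Union>\<C>" using ideal ideal_multD by blast
qed

text \<open>For an ideal \<open>P\<close> that is maximal among those containing \<open>I\<close> and omitting \<open>x\<close>, every strictly
  larger ideal contains \<open>x\<close>. If \<open>a \<sqinter> b \<in> P\<close> with \<open>a, b \<notin> P\<close>, the colon ideal of \<open>a\<close> is strictly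
  larger since it contains \<open>b\<close>, so \<open>x \<sqinter> a \<in> P\<close>. Then the colon ideal of \<open>x\<close> is strictly larger since it
  contains \<open>a\<close>, so \<open>x = x \<sqinter> x \<in> P\<close>, a contradiction.\<close>

lemma prime_ideal_separation:
  assumes I: "ideal I" and x: "x \<in> A" "x \<notin> I"
  obtains P where "prime_ideal P" "I \<subseteq> P" "x \<notin> P"
proof -
  define \<A> where "\<A> = {J. ideal J \<and> I \<subseteq> J \<and> x \<notin> J}"
  have "I \<in> \<A>" using I x by (simp add: \<A>_def)
  then have "\<exists>P\<in>\<A>. \<forall>J\<in>\<A>. P \<subseteq> J \<longrightarrow> J = P"
  proof (intro subset_Zorn_nonempty)
    fix \<C> assume "\<C> \<noteq> {}" "subset.chain \<A> \<C>"
    then have sub: "\<C> \<subseteq> \<A>" and "\<And>J K. J \<in> \<C> \<Longrightarrow> K \<in> \<C> \<Longrightarrow> J \<subseteq> K \<or> K \<subseteq> J"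
      by (auto simp: subset_chain_def)
    moreover have "\<And>J. J \<in> \<C> \<Longrightarrow> ideal J" using sub by (auto simp: \<A>_def)
    ultimately have "ideal (\<Union>\<C>)" using \<open>\<C> \<noteq> {}\<close> ideal_Union_chain by blast
    then show "\<Union>\<C> \<in> \<A>" using sub \<open>\<C> \<noteq> {}\<close> by (auto simp: \<A>_def)
  qed auto
  then obtain P where "P \<in> \<A>" and max: "\<And>J. J \<in> \<A> \<Longrightarrow> P \<subseteq> J \<Longrightarrow> J = P"
    by auto
  then have P: "ideal P" "I \<subseteq> P" "x \<notin> P" by (simp_all add: \<A>_def)
  have absorb: "x \<sqinter> a \<in> P" if "a \<in> A" "b \<in> A" "b \<sqinter> a \<in> P" "b \<notin> P" for a b
  proof (rule ccontr)
    assume "x \<sqinter> a \<notin> P"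
    then have "{y \<in> A. y \<sqinter> a \<in> P} \<in> \<A>"
      using P that ideal_colon[of P a] ideal_subset_colon[of P a] by (auto simp: \<A>_def)
    then have "{y \<in> A. y \<sqinter> a \<in> P} = P"
      using max ideal_subset_colon P that by blast
    then show False using that by blast
  qed
  have "prime_ideal P"
    unfolding prime_ideal_def
  proof (intro conjI ballI impI)
    show "P \<noteq> A" using x P by blast
  next
    fix a b assume ab: "a \<in> A" "b \<in> A" "a \<sqinter> b \<in> P"
    show "a \<in> P \<or> b \<in> P"
    proof (rule ccontr)
      assume nin: "\<not> (a \<in> P \<or> b \<in> P)"
      have "x \<sqinter> a \<in> P"
        using absorb[of a b] ab nin by (simp add: meet_commute)
      then have "x \<sqinter> x \<in> P"
        using absorb[of x a] ab x nin by (simp add: meet_commute)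
      then show False using x P by (simp add: meet_idem)
    qed
  qed (rule P)
  with P that show thesis by blast
qed

section \<open>Basic open sets\<close>

definition basic_open :: "'a \<Rightarrow> 'a set set"
  where "basic_open a = {P. prime_ideal P \<and> a \<notin> P}"

lemma prime_ideal_ideal: "prime_ideal P \<Longrightarrow> ideal P"
  by (simp add: prime_ideal_def)

lemma basic_open_zero: "basic_open \<zero> = {}"
  by (auto simp: basic_open_def dest: prime_ideal_ideal zero_in_ideal)

lemma basic_open_subset_Un:
  assumes "x \<in> A"
  shows "basic_open x \<subseteq> basic_open (x \<cdot> y) \<union> basic_open y"
  using assms ideal_multD by (auto simp: basic_open_def prime_ideal_def)

lemma basic_open_meet:
  assumes "a \<in> A" "b \<in> A"
  shows "basic_open (a \<sqinter> b) = basic_open a \<inter> basic_open b"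
  using assms ideal_meet_left ideal_meet_right
  by (auto simp: basic_open_def prime_ideal_def)

lemma sigma_eq_UN: "\<sigma> I = (\<Union>y\<in>I. basic_open y)"
  by (auto simp: sigma_def basic_open_def)

text \<open>The predicate \<open>Q\<close> describes a set-theoretic ideal of subsets of the spectrum. Openness and
  compactness of basic open sets and the generic points of irreducible closed sets all come from
  suitable choices of \<open>Q\<close>.\<close>

lemma ideal_covered:
  assumes "Q {}" and Un: "\<And>S T. Q S \<Longrightarrow> Q T \<Longrightarrow> Q (S \<union> T)"
    and mono: "\<And>S T. Q T \<Longrightarrow> S \<subseteq> T \<Longrightarrow> Q S"
  shows "ideal {y \<in> A. Q (basic_open y)}"
  unfolding ideal_def
proof (intro conjI ballI impI)
  show "\<zero> \<in> {y \<in> A. Q (basic_open y)}"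
    using \<open>Q {}\<close> by (simp add: zero_closed basic_open_zero)
next
  fix x y
  assume x: "x \<in> A" and "x \<cdot> y \<in> {y \<in> A. Q (basic_open y)} \<and> y \<in> {y \<in> A. Q (basic_open y)}"
  then have "Q (basic_open (x \<cdot> y) \<union> basic_open y)" using Un by blast
  then show "x \<in> {y \<in> A. Q (basic_open y)}"
    using mono basic_open_subset_Un x by blast
qed auto

lemma openin_basic_open:
  assumes "a \<in> A"
  shows "openin spectrum (basic_open a)"
proof -
  let ?I = "{y \<in> A. basic_open y \<subseteq> basic_open a}"
  have "ideal ?I" by (rule ideal_covered) auto
  moreover have "basic_open a = \<sigma> ?I"
    using assms unfolding sigma_eq_UN by blast
  ultimately show ?thesis unfolding openin_spectrum by blast
qed

text \<open>Given an open cover of \<open>basic_open a\<close>, let \<open>J\<close> be the ideal of elements whose basic open set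
  has a finite subcover. Every ideal \<open>I\<close> with \<open>\<sigma> I\<close> in the cover is contained in \<open>J\<close>. So a prime ideal
  that contains \<open>J\<close> and omits \<open>a\<close> would be a point of \<open>basic_open a\<close> that the cover misses; by
  separation, \<open>a \<in> J\<close>.\<close>

lemma compactin_basic_open:
  assumes a: "a \<in> A"
  shows "compactin spectrum (basic_open a)"
  unfolding compactin_def
proof (intro conjI allI impI)
  show "basic_open a \<subseteq> topspace spectrum"
    by (auto simp: basic_open_def topspace_spectrum)
next
  fix \<U> assume "(\<forall>U\<in>\<U>. openin spectrum U) \<and> basic_open a \<subseteq> \<Union>\<U>"
  then have op: "\<And>U. U \<in> \<U> \<Longrightarrow> openin spectrum U" and cov: "basic_open a \<subseteq> \<Union>\<U>" by auto
  define fin_cov where "fin_cov S \<longleftrightarrow> (\<exists>\<F>. finite \<F> \<and> \<F> \<subseteq> \<U> \<and> S \<subseteq> \<Union>\<F>)" for S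
  define J where "J = {y \<in> A. fin_cov (basic_open y)}"
  have "ideal J"
    unfolding J_def
  proof (rule ideal_covered)
    show "fin_cov {}" unfolding fin_cov_def by blast
    show "fin_cov S" if "fin_cov T" "S \<subseteq> T" for S T
      using that unfolding fin_cov_def by blast
    show "fin_cov (S \<union> T)" if ST: "fin_cov S" "fin_cov T" for S T
    proof -
      obtain \<F> \<G> where "finite \<F>" "\<F> \<subseteq> \<U>" "S \<subseteq> \<Union>\<F>" "finite \<G>" "\<G> \<subseteq> \<U>" "T \<subseteq> \<Union>\<G>"
        using ST unfolding fin_cov_def by blast
      then have "finite (\<F> \<union> \<G>) \<and> \<F> \<union> \<G> \<subseteq> \<U> \<and> S \<union> T \<subseteq> \<Union>(\<F> \<union> \<G>)" by blast
      then show ?thesis unfolding fin_cov_def by blast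
    qed
  qed
  have "a \<in> J"
  proof (rule ccontr)
    assume "a \<notin> J"
    then obtain P where P: "prime_ideal P" "J \<subseteq> P" "a \<notin> P"
      using prime_ideal_separation \<open>ideal J\<close> a by blast
    then have "P \<in> basic_open a" by (simp add: basic_open_def)
    then obtain U where U: "U \<in> \<U>" "P \<in> U" using cov by blast
    then obtain I where I: "ideal I" "U = \<sigma> I" using op openin_spectrum by blast
    have "I \<subseteq> J"
    proof
      fix y assume y: "y \<in> I"
      have "finite {U} \<and> {U} \<subseteq> \<U> \<and> basic_open y \<subseteq> \<Union>{U}"
        using y U I by (auto simp: sigma_eq_UN)
      then have "fin_cov (basic_open y)" unfolding fin_cov_def by blast
      then show "y \<in> J" using y I ideal_subset unfolding J_def by blast
    qed
    then show False using P U I by (auto simp: sigma_def)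
  qed
  then show "\<exists>\<F>. finite \<F> \<and> \<F> \<subseteq> \<U> \<and> basic_open a \<subseteq> \<Union>\<F>"
    by (simp add: J_def fin_cov_def)
qed

lemma compact_openin_iff:
  "compact_openin spectrum U \<longleftrightarrow> (\<exists>F. finite F \<and> F \<subseteq> A \<and> U = (\<Union>a\<in>F. basic_open a))"
proof
  assume U: "compact_openin spectrum U"
  then have "openin spectrum U" by simp
  then obtain I where I: "ideal I" "U = (\<Union>a\<in>I. basic_open a)"
    by (auto simp: openin_spectrum sigma_eq_UN)
  then have "I \<subseteq> A" by (simp add: ideal_subset)
  then have "\<And>V. V \<in> basic_open ` I \<Longrightarrow> openin spectrum V"
    using openin_basic_open by blast
  moreover have "U \<subseteq> \<Union>(basic_open ` I)" using I by simp
  ultimately obtain \<F> where \<F>: "finite \<F>" "\<F> \<subseteq> basic_open ` I" "U \<subseteq> \<Union>\<F>"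
    using compactinD[of spectrum U "basic_open ` I"] U by blast
  then obtain F where F: "F \<subseteq> I" "finite F" "\<F> = basic_open ` F"
    by (meson finite_subset_image)
  have "U = (\<Union>a\<in>F. basic_open a)" using \<F>(3) F(1,3) I(2) by blast
  then show "\<exists>F. finite F \<and> F \<subseteq> A \<and> U = (\<Union>a\<in>F. basic_open a)"
    using F \<open>I \<subseteq> A\<close> by blast
next
  assume "\<exists>F. finite F \<and> F \<subseteq> A \<and> U = (\<Union>a\<in>F. basic_open a)"
  then obtain F where "finite F" "F \<subseteq> A" "U = (\<Union>a\<in>F. basic_open a)" by blast
  then show "compact_openin spectrum U"
    by (auto intro!: openin_Union compactin_Union openin_basic_open compactin_basic_open)
qed

lemma compact_openin_basic_open: "a \<in> A \<Longrightarrow> compact_openin spectrum (basic_open a)"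
  by (simp add: openin_basic_open compactin_basic_open)

lemma compact_openin_Int:
  assumes "compact_openin spectrum U" "compact_openin spectrum V"
  shows "compact_openin spectrum (U \<inter> V)"
proof -
  obtain F G where F: "finite F" "F \<subseteq> A" "U = (\<Union>a\<in>F. basic_open a)"
    and G: "finite G" "G \<subseteq> A" "V = (\<Union>b\<in>G. basic_open b)"
    using assms unfolding compact_openin_iff by blast
  let ?H = "(\<lambda>(a, b). a \<sqinter> b) ` (F \<times> G)"
  have "U \<inter> V = (\<Union>a\<in>F. \<Union>b\<in>G. basic_open a \<inter> basic_open b)" using F G by blast
  also have "\<dots> = (\<Union>a\<in>F. \<Union>b\<in>G. basic_open (a \<sqinter> b))"
    using F G by (intro SUP_cong refl) (simp add: basic_open_meet subset_iff)
  also have "\<dots> = (\<Union>c\<in>?H. basic_open c)" by auto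
  finally have "U \<inter> V = (\<Union>c\<in>?H. basic_open c)" .
  moreover have "finite ?H" "?H \<subseteq> A" using F G by (auto intro: meet_closed)
  ultimately show ?thesis unfolding compact_openin_iff by blast
qed

section \<open>The topology of the spectrum\<close>

lemma prime_ideal_in_basic_open:
  assumes "prime_ideal P"
  obtains a where "a \<in> A" "P \<in> basic_open a"
  using assms ideal_subset by (auto simp: prime_ideal_def basic_open_def)

lemma locally_compact_spectrum: "locally_compact_space spectrum"
  unfolding locally_compact_space_def
proof
  fix P assume "P \<in> topspace spectrum"
  then have "prime_ideal P" by (simp add: topspace_spectrum)
  then obtain a where "a \<in> A" "P \<in> basic_open a"
    by (rule prime_ideal_in_basic_open)
  then show "\<exists>U K. openin spectrum U \<and> compactin spectrum K \<and> P \<in> U \<and> U \<subseteq> K"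
    using compact_openin_basic_open by blast
qed

lemma t0_spectrum: "t0_space spectrum"
  unfolding t0_space_def
proof (intro ballI impI)
  fix P Q assume PQ: "P \<in> topspace spectrum" "Q \<in> topspace spectrum" "P \<noteq> Q"
  then have prime: "prime_ideal P" "prime_ideal Q" by (simp_all add: topspace_spectrum)
  obtain a where "a \<in> P \<longleftrightarrow> a \<notin> Q" using \<open>P \<noteq> Q\<close> by blast
  moreover from this have "a \<in> A"
    using prime prime_ideal_ideal ideal_subset by blast
  ultimately show "\<exists>U. openin spectrum U \<and> (P \<notin> U \<longleftrightarrow> Q \<in> U)"
    using prime openin_basic_open[of a] by (intro exI[of _ "basic_open a"]) (simp add: basic_open_def)
qed

lemma openin_spectrum_union_of:
  "openin spectrum = arbitrary union_of (compact_openin spectrum)"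
proof
  fix U
  have "(arbitrary union_of (compact_openin spectrum)) U" if U: "openin spectrum U"
  proof -
    obtain I where I: "ideal I" "U = (\<Union>y\<in>I. basic_open y)"
      using U by (auto simp: openin_spectrum sigma_eq_UN)
    then have "basic_open ` I \<subseteq> Collect (compact_openin spectrum)"
      using compact_openin_basic_open ideal_subset by blast
    then show ?thesis unfolding union_of_def arbitrary_def using I by blast
  qed
  moreover have "openin spectrum U" if "(arbitrary union_of (compact_openin spectrum)) U"
    using that unfolding union_of_def arbitrary_def by blast
  ultimately show "openin spectrum U = (arbitrary union_of (compact_openin spectrum)) U"
    by blast
qed

text \<open>Specialization between prime ideals is inclusion.\<close>

lemma closure_of_prime_ideal:
  assumes "prime_ideal P"
  shows "spectrum closure_of {P} = {Q. prime_ideal Q \<and> P \<subseteq> Q}"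
proof (intro equalityI subsetI)
  fix Q assume Q: "Q \<in> spectrum closure_of {P}"
  then have "prime_ideal Q" by (simp add: in_closure_of topspace_spectrum)
  moreover have "a \<in> Q" if "a \<in> P" for a
  proof (rule ccontr)
    assume "a \<notin> Q"
    have "a \<in> A" using that assms prime_ideal_ideal ideal_subset by blast
    moreover have "Q \<in> basic_open a"
      using \<open>prime_ideal Q\<close> \<open>a \<notin> Q\<close> by (simp add: basic_open_def)
    ultimately have "P \<in> basic_open a"
      using Q openin_basic_open[of a] by (auto simp: in_closure_of)
    then show False using that by (simp add: basic_open_def)
  qed
  ultimately show "Q \<in> {Q. prime_ideal Q \<and> P \<subseteq> Q}" by blast
next
  fix Q assume "Q \<in> {Q. prime_ideal Q \<and> P \<subseteq> Q}"
  then show "Q \<in> spectrum closure_of {P}"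
    using assms by (auto simp: in_closure_of topspace_spectrum openin_spectrum sigma_def)
qed

text \<open>The generic point of an irreducible closed set is the intersection of its members.
  Irreducibility makes this ideal prime: two open sets that meet \<open>C\<close> have an intersection that
  meets \<open>C\<close>, and \<open>basic_open\<close> turns meets into intersections.\<close>

lemma quasi_sober_spectrum: "quasi_sober spectrum"
  unfolding quasi_sober_def
proof (intro allI impI)
  fix C assume "irreducible_closedin spectrum C"
  then have C: "closedin spectrum C" "C \<noteq> {}"
    and irred: "\<And>F G. closedin spectrum F \<Longrightarrow> closedin spectrum G \<Longrightarrow> C = F \<union> G \<Longrightarrow> C = F \<or> C = G"
    unfolding irreducible_closedin_def by blast+
  define P where "P = {y \<in> A. basic_open y \<inter> C = {}}"
  have C_prime: "prime_ideal Q" if "Q \<in> C" for Q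
    using closedin_subset[OF C(1)] that by (auto simp: topspace_spectrum)
  have P_sub: "P \<subseteq> Q" if "Q \<in> C" for Q
    using that C_prime[OF that] by (auto simp: P_def basic_open_def)
  have "prime_ideal P"
    unfolding prime_ideal_def
  proof (intro conjI ballI impI)
    show "ideal P" unfolding P_def by (rule ideal_covered) auto
    obtain Q where Q: "Q \<in> C" using C by blast
    then obtain a where "a \<in> A" "a \<notin> Q"
      using C_prime prime_ideal_in_basic_open unfolding basic_open_def by blast
    then show "P \<noteq> A" using P_sub[OF Q] by blast
  next
    fix a b assume ab: "a \<in> A" "b \<in> A" "a \<sqinter> b \<in> P"
    then have "basic_open a \<inter> basic_open b \<inter> C = {}"
      by (simp add: P_def basic_open_meet)
    then have "C = (C - basic_open a) \<union> (C - basic_open b)" by blast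
    moreover have "closedin spectrum (C - basic_open a)" "closedin spectrum (C - basic_open b)"
      using ab C by (simp_all add: closedin_diff openin_basic_open)
    ultimately have "C = C - basic_open a \<or> C = C - basic_open b" using irred by blast
    then show "a \<in> P \<or> b \<in> P" using ab by (auto simp: P_def)
  qed
  moreover have "C = {Q. prime_ideal Q \<and> P \<subseteq> Q}"
  proof (intro equalityI subsetI)
    fix Q assume "Q \<in> {Q. prime_ideal Q \<and> P \<subseteq> Q}"
    then have Q: "prime_ideal Q" "P \<subseteq> Q" by auto
    obtain I where I: "ideal I" "topspace spectrum - C = \<sigma> I"
      using C(1) unfolding closedin_def openin_spectrum by blast
    then have "basic_open y \<inter> C = {}" if "y \<in> I" for y
      using that unfolding sigma_eq_UN by blast
    then have "I \<subseteq> P" using I ideal_subset unfolding P_def by blast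
    then have "Q \<notin> \<sigma> I" using Q by (auto simp: sigma_def)
    then show "Q \<in> C" using Q I by (auto simp: topspace_spectrum)
  qed (use C_prime P_sub in blast)
  ultimately show "\<exists>P\<in>topspace spectrum. C = spectrum closure_of {P}"
    using closure_of_prime_ideal by (auto simp: topspace_spectrum)
qed

lemma generalized_spectral_spectrum: "generalized_spectral_space spectrum"
  unfolding generalized_spectral_space_def
  using t0_spectrum openin_spectrum_union_of compact_openin_Int quasi_sober_spectrum by blast

end

theorem theorem4p12:
  fixes A :: "'a set" and bmult :: "'a \<Rightarrow> 'a \<Rightarrow> 'a" and zero :: 'a
  assumes "comm_bck_algebra A bmult zero"
  shows "locally_compact_space (comm_bck_algebra.spectrum A bmult zero) \<and>
         generalized_spectral_space (comm_bck_algebra.spectrum A bmult zero)"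
  using comm_bck_algebra.locally_compact_spectrum[OF assms]
    comm_bck_algebra.generalized_spectral_spectrum[OF assms] ..

end
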